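(* Let $\mathcal{T}$ be a triangle with circumcircle $\mathcal{C}$, and let $\mathcal{I}$ be an inversion circle centred at a point $D$ lying neither on the side lines of $\mathcal{T}$ nor on $\mathcal{C}$. The polars of the vertices of $\mathcal{T}$ with respect to $\mathcal{I}$ determine a new triangle $\mathcal{T}_p$; let $\mathcal{C}_p$ be its circumcircle. Then $[\mathcal{C}_p,\mathcal{C}]$ form a polar-poristic pair of circles, in the following sense. Let $A$ be any point of $\mathcal{C}$ whose polar meets $\mathcal{C}_p$ in two distinct points $B_p$ and $C_p$, and let the polar of $B_p$ meet $\mathcal{C}$ in $A$ and $C$, and the polar of $C_p$ meet $\mathcal{C}$ in $A$ and $B$ (with $B\ne A$, $C\neq A$). Let $A_p$ be the pole of the line $BC$. Then: (i) the triangles $ABC$ and $A_pB_pC_p$ are polar to each other: the vertices of each are the poles of the sides of the other; (ii) $A_p$ lies on the circle $\mathcal{C}_p$.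
   Context: All objects are in the real Euclidean plane and triangles are non-degenerate. A "side" of a triangle means the full line through two of its vertices. Poles and polars are taken with respect to the circle $\mathcal{I}$ centred at $D$: the polar of a point $P\neq D$ is the line perpendicular to $DP$ through the inverse of $P$ in $\mathcal{I}$, and the pole of a line $\ell$ not through $D$ is the point whose polar is $\ell$. *)

theory Defs
  imports "HOL-Analysis.Analysis"
begin

type_synonym point = "real ^ 2"

abbreviation line :: "point \<Rightarrow> point \<Rightarrow> point set" where
  "line P Q \<equiv> affine hull {P, Q}"

definition is_triangle :: "point \<Rightarrow> point \<Rightarrow> point \<Rightarrow> bool" where
  "is_triangle P Q S \<longleftrightarrow> \<not> collinear {P, Q, S}"

definition is_circle :: "point set \<Rightarrow> bool" where
  "is_circle K \<longleftrightarrow> (\<exists>c r. 0 < r \<and> K = sphere c r)"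

definition is_circumcircle :: "point set \<Rightarrow> point \<Rightarrow> point \<Rightarrow> point \<Rightarrow> bool" where
  "is_circumcircle K P Q S \<longleftrightarrow> is_circle K \<and> P \<in> K \<and> Q \<in> K \<and> S \<in> K"

text \<open>The circle of inversion has centre \<open>D\<close> and radius \<open>R\<close>.
  Inverse and polar are meaningful only for \<open>P \<noteq> D\<close>.\<close>

definition inversion :: "point \<Rightarrow> real \<Rightarrow> point \<Rightarrow> point" where
  "inversion D R P = D + (R\<^sup>2 / (dist D P)\<^sup>2) *\<^sub>R (P - D)"

definition polar :: "point \<Rightarrow> real \<Rightarrow> point \<Rightarrow> point set" where
  "polar D R P = {X. (X - inversion D R P) \<bullet> (P - D) = 0}"

definition is_pole :: "point \<Rightarrow> real \<Rightarrow> point \<Rightarrow> point set \<Rightarrow> bool" where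
  "is_pole D R P l \<longleftrightarrow> P \<noteq> D \<and> polar D R P = l"

definition polar_triangles ::
    "point \<Rightarrow> real \<Rightarrow> point \<Rightarrow> point \<Rightarrow> point \<Rightarrow> point \<Rightarrow> point \<Rightarrow> point \<Rightarrow> bool" where
  "polar_triangles D R A B C A' B' C' \<longleftrightarrow>
     is_triangle A B C \<and> is_triangle A' B' C' \<and>
     is_pole D R A' (line B C) \<and> is_pole D R B' (line C A) \<and> is_pole D R C' (line A B) \<and>
     is_pole D R A (line B' C') \<and> is_pole D R B (line C' A') \<and> is_pole D R C (line A' B')"

text \<open>In the next definition \<open>Kp\<close> and \<open>K\<close> are the circles, in the order of the pair.
  The existence of the pole \<open>Ap\<close> of \<open>BC\<close>, i.e. that \<open>D\<close> is not on \<open>BC\<close>, is part of the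
  conclusion; a line has at most one pole, so \<open>Ap\<close> is uniquely determined.\<close>

definition polar_poristic_pair :: "point \<Rightarrow> real \<Rightarrow> point set \<Rightarrow> point set \<Rightarrow> bool" where
  "polar_poristic_pair D R Kp K \<longleftrightarrow>
     (\<forall>A B C Bp Cp.
        A \<in> K \<longrightarrow>
        polar D R A \<inter> Kp = {Bp, Cp} \<longrightarrow> Bp \<noteq> Cp \<longrightarrow>
        polar D R Bp \<inter> K = {A, C} \<longrightarrow> C \<noteq> A \<longrightarrow>
        polar D R Cp \<inter> K = {A, B} \<longrightarrow> B \<noteq> A \<longrightarrow>
        (\<exists>Ap. is_pole D R Ap (line B C) \<and>
              polar_triangles D R A B C Ap Bp Cp \<and>
              Ap \<in> Kp))"

end

theory Submission imports Defs begin

text \<open>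
  Normalise \<open>K\<close> to the unit circle of the complex plane and let \<open>d\<close> be the coordinate of \<open>D\<close>.
  Polarity with respect to a circle centred at \<open>D\<close> carries the circle \<open>Kp\<close> to a conic with one
  focus at \<open>d\<close>, and the points of \<open>Kp\<close> to the tangents of that conic.
  The theorem is therefore Poncelet's porism for triangles inscribed in the unit circle and
  circumscribed about a conic with foci \<open>d\<close> and \<open>d'\<close>, where \<open>d'\<close> is the isogonal conjugate of
  \<open>d\<close> in the given triangle.

  That porism has a short proof by Blaschke products. The chord \<open>xy\<close> of the unit circle touches the
  conic iff the product of its signed distances from the foci is the square of the minor
  semi-axis (minus the square of the conjugate semi-axis for a hyperbola). This is a symmetric
  polynomial relation between \<open>x\<close> and \<open>y\<close>, called \<open>tangent_chord\<close> below. Multiplied by \<open>x - y\<close>, it becomes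
  \<open>N x * M y = N y * M x\<close> with \<open>N z / M z = z (z - d) (z - d') / ((1 - cnj d z) (1 - cnj d' z))\<close>
  (lemma \<open>tangent_chord_iff_blaschke\<close>). So two distinct points of the unit circle span a tangent
  iff the Blaschke product takes the same value at both, and tangency of \<open>xy\<close> and \<open>xz\<close>
  entails tangency of \<open>yz\<close> (lemma \<open>tangent_chord_transitive\<close>).
  The vertices of the given triangle are made to share a value by solving for \<open>d'\<close>
  (lemma \<open>exists_second_focus\<close>).

  The pole \<open>q\<close> of a chord \<open>xy\<close>, taken relative to \<open>d\<close>, satisfies \<open>q = x y cnj q\<close>. Through this
  identity the tangency of \<open>xy\<close> becomes the equation of a circle in \<open>q\<close>
  (lemma \<open>pole_on_dual_circle_iff\<close>), and that circle is \<open>Kp\<close>. Finally, a tangent chord cannot pass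
  through \<open>d\<close>, which is why the pole of \<open>BC\<close> exists.
\<close>

section \<open>Poles, polars and polar triangles\<close>

lemma mem_polar:
  assumes "P \<noteq> D"
  shows "X \<in> polar D R P \<longleftrightarrow> (X - D) \<bullet> (P - D) = R\<^sup>2"
proof -
  have "(P - D) \<bullet> (P - D) = (dist D P)\<^sup>2"
    by (metis dist_commute dist_norm power2_norm_eq_inner)
  moreover have "dist D P \<noteq> 0" using assms by auto
  ultimately show ?thesis 
    by (simp add: polar_def inversion_def diff_diff_eq[symmetric] inner_diff_left)
qed

lemma centre_notin_polar: "P \<noteq> D \<Longrightarrow> 0 < R \<Longrightarrow> D \<notin> polar D R P"
  by (simp add: mem_polar)

lemma polar_reciprocal: "P \<noteq> D \<Longrightarrow> Q \<noteq> D \<Longrightarrow> P \<in> polar D R Q \<longleftrightarrow> Q \<in> polar D R P"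
  by (simp add: mem_polar inner_commute)

lemma endpoints_in_line: "X \<in> line X Y" "Y \<in> line X Y"
  by (simp_all add: hull_inc)

lemma polar_eq_line:
  assumes "P \<noteq> D" "X \<noteq> Y" "X \<in> polar D R P" "Y \<in> polar D R P"
  shows "polar D R P = line X Y"
proof -
  have h: "polar D R P = {Z. (P - D) \<bullet> Z = R\<^sup>2 + (P - D) \<bullet> D}"
    using assms(1) by (auto simp: mem_polar inner_diff_left inner_diff_right inner_commute)
  have "line X Y = polar D R P"
  proof (rule affine_dim_equal)
    show "affine (polar D R P)" unfolding h by (rule affine_hyperplane)
    then show "line X Y \<subseteq> polar D R P" using assms by (intro hull_minimal) auto
    show "aff_dim (line X Y) = aff_dim (polar D R P)"
      unfolding h using assms by (simp add: aff_dim_hyperplane)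
  qed auto
  then show ?thesis ..
qed

lemma pole_exists:
  assumes "D \<notin> line X Y" "X \<noteq> Y" "0 < R"
  shows "\<exists>P. is_pole D R P (line X Y)"
proof -
  have "aff_dim (line X Y) = int DIM(point) - 1" using assms(2) by simp
  then obtain a b where ab: "a \<noteq> 0" "line X Y = {Z. a \<bullet> Z = b}"
    using aff_dim_eq_hyperplane[of "line X Y"] by auto
  define P where "P = D + (R\<^sup>2 / (b - a \<bullet> D)) *\<^sub>R a"
  have nz: "b - a \<bullet> D \<noteq> 0" using assms(1) ab by auto
  then have "P \<noteq> D" using ab(1) assms(3) by (simp add: P_def)
  moreover have "X \<in> polar D R P" "Y \<in> polar D R P"
  proof -
    have "a \<bullet> X = b" "a \<bullet> Y = b" using ab(2) endpoints_in_line[of X Y] endpoints_in_line[of Y X]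
      by auto
    then show "X \<in> polar D R P" "Y \<in> polar D R P"
      unfolding mem_polar[OF \<open>P \<noteq> D\<close>] using nz
      by (simp_all add: P_def inner_diff_left inner_diff_right inner_commute[of _ a])
  qed
  ultimately show ?thesis using polar_eq_line assms(2) unfolding is_pole_def by blast
qed

lemma pole_unique:
  assumes "is_pole D R P l" "is_pole D R Q l" "0 < R"
  shows "P = Q"
proof -
  have nz: "P \<noteq> D" "Q \<noteq> D" and eq: "polar D R P = polar D R Q"
    using assms by (auto simp: is_pole_def)
  \<comment> \<open>The inverse of \<open>Y\<close> lies on the common polar, so the equation of the polar of \<open>Z\<close> holds at it.\<close>
  have foot: "(Y - D) \<bullet> (Z - D) = (Y - D) \<bullet> (Y - D)" 
    if "Y \<noteq> D" "Z \<noteq> D" "polar D R Y = polar D R Z" for Y Z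
  proof -
    have "inversion D R Y \<in> polar D R Y" by (simp add: polar_def)
    then have "(inversion D R Y - D) \<bullet> (Z - D) = R\<^sup>2" using that mem_polar by blast
    moreover have "(Y - D) \<bullet> (Y - D) = (dist D Y)\<^sup>2"
      by (metis dist_commute dist_norm power2_norm_eq_inner)
    moreover have "dist D Y \<noteq> 0" using that by simp
    ultimately show ?thesis using assms(3) by (simp add: inversion_def divide_eq_eq)
  qed
  have "(P - Q) \<bullet> (P - Q) = 0"
    using foot[OF nz eq] foot[OF nz(2,1) eq[symmetric]]
    by (simp add: inner_diff_left inner_diff_right inner_commute)
  then show ?thesis by simp
qed

lemma is_triangle_iff:
  "is_triangle P Q S \<longleftrightarrow> P \<noteq> Q \<and> S \<notin> line P Q"
  unfolding is_triangle_def
  by (cases "P = Q") (auto simp: collinear_3_affine_hull)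

lemma is_triangle_rotate: "is_triangle P Q S \<longleftrightarrow> is_triangle Q S P"
  by (simp add: is_triangle_def insert_commute)

text \<open>By reciprocity the polar of \<open>A\<close> contains the poles \<open>B'\<close> and \<open>C'\<close> of the two sides through
  \<open>A\<close>. If \<open>A'\<close> were on it as well, \<open>A\<close> would lie on the polar \<open>BC\<close> of \<open>A'\<close>.\<close>

lemma polar_trianglesI:
  assumes "0 < R" and t: "is_triangle A B C"
    and p: "is_pole D R A' (line B C)" "is_pole D R B' (line C A)" "is_pole D R C' (line A B)"
  shows "polar_triangles D R A B C A' B' C'"
proof -
  have p': "A' \<noteq> D" "B' \<noteq> D" "C' \<noteq> D"
    "polar D R A' = line B C" "polar D R B' = line C A" "polar D R C' = line A B"
    using p by (auto simp: is_pole_def)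
  have t': "C \<notin> line A B" "A \<notin> line B C" "B \<notin> line C A"
    using t is_triangle_iff is_triangle_rotate by blast+
  note mem = endpoints_in_line
  have D: "D \<noteq> A" "D \<noteq> B" "D \<noteq> C" using centre_notin_polar[OF _ assms(1)] p' mem by metis+
  have ne: "A' \<noteq> B'" "B' \<noteq> C'" "C' \<noteq> A'" using p' t' mem by metis+
  have m: "B' \<in> polar D R A" "C' \<in> polar D R A" "C' \<in> polar D R B" "A' \<in> polar D R B"
       "A' \<in> polar D R C" "B' \<in> polar D R C"
    using polar_reciprocal p' D mem by metis+
  have q: "is_pole D R A (line B' C')" "is_pole D R B (line C' A')" "is_pole D R C (line A' B')"
    unfolding is_pole_def using m ne D polar_eq_line by metis+
  have "is_triangle B' C' A'"
    unfolding is_triangle_iff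
  proof
    show "A' \<notin> line B' C'"
      using q(1) polar_reciprocal[of A D A' R] p' t' by (auto simp: is_pole_def)
  qed (fact ne)
  then show ?thesis unfolding polar_triangles_def using t p q is_triangle_rotate by blast
qed

lemma triangle_sides_meet_at_vertex:
  assumes "is_triangle A B C"
  shows "line B A \<inter> line A C = {A}"
proof -
  have "Y = A" if "Y \<in> line B A" "Y \<in> line A C" for Y
  proof (rule ccontr)
    assume "Y \<noteq> A"
    have "B \<noteq> A" "A \<noteq> C" using assms by (auto simp: is_triangle_def insert_commute)
    then have "collinear {B, A, Y}" "collinear {A, C, Y}"
      using that by (simp_all add: collinear_3_affine_hull)
    then have "collinear {B, A, C}"
      using collinear_3_trans[of B A Y C] \<open>Y \<noteq> A\<close> collinear_3_trans[of B Y A C]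
      by (metis insert_commute)
    then show False using assms by (simp add: is_triangle_def insert_commute)
  qed
  then show ?thesis using endpoints_in_line by blast
qed

section \<open>Chords of the unit circle tangent to a conic with given foci\<close>

text \<open>For \<open>x\<close> and \<open>y\<close> on the unit circle, \<open>z + x y cnj z = x + y\<close> is the equation of the line
  through them, and \<open>chord d x y\<close> is its value at \<open>d\<close>: twice the signed distance of \<open>d\<close> from the
  line, times a square root of \<open>x y\<close>.\<close>

definition chord :: "complex \<Rightarrow> complex \<Rightarrow> complex \<Rightarrow> complex" where
  "chord d x y = x + y - d - x * y * cnj d"

text \<open>The power of \<open>d\<close> with respect to the unit circle, up to sign.\<close>

definition neg_power :: "complex \<Rightarrow> complex" where
  "neg_power d = 1 - d * cnj d"

text \<open>The product of the signed distances of the foci \<open>d\<close> and \<open>d'\<close> from the chord is required to be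
  \<open>(1 - |d|\<^sup>2) (1 - |d'|\<^sup>2) / 4\<close>. This is the square of the minor semi-axis of an ellipse with these
  foci that is inscribed in triangles of the unit circle; for a hyperbola it is negative.
  When \<open>d = d'\<close> it is Euler's relation between circumradius, inradius and the distance of the
  centres.\<close>

definition tangent_chord :: "complex \<Rightarrow> complex \<Rightarrow> complex \<Rightarrow> complex \<Rightarrow> bool" where
  "tangent_chord d d' x y \<longleftrightarrow>
     chord d x y * chord d' x y = neg_power d * neg_power d' * (x * y)"

text \<open>Numerator and denominator of the Blaschke product with zeros \<open>0\<close>, \<open>d\<close> and \<open>d'\<close>; the pair is
  kept in place of the quotient because the foci may lie outside the unit circle.\<close>

definition blaschke_num :: "complex \<Rightarrow> complex \<Rightarrow> complex \<Rightarrow> complex" where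
  "blaschke_num d d' z = z * (z - d) * (z - d')"

definition blaschke_den :: "complex \<Rightarrow> complex \<Rightarrow> complex \<Rightarrow> complex" where
  "blaschke_den d d' z = (1 - cnj d * z) * (1 - cnj d' * z)"

lemma tangent_chord_iff_blaschke:
  assumes "x \<noteq> y"
  shows "tangent_chord d d' x y \<longleftrightarrow>
    blaschke_num d d' x * blaschke_den d d' y = blaschke_num d d' y * blaschke_den d d' x"
proof -
  have "(x - y) * (chord d x y * chord d' x y - neg_power d * neg_power d' * (x * y)) =
    blaschke_num d d' x * blaschke_den d d' y - blaschke_num d d' y * blaschke_den d d' x"
    unfolding blaschke_num_def blaschke_den_def chord_def neg_power_def by algebra
  then show ?thesis using assms unfolding tangent_chord_def
    by (metis (no_types, lifting) eq_iff_diff_eq_0 mult_eq_0_iff)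
qed

lemma unit_mult_cnj: "norm (x::complex) = 1 \<Longrightarrow> x * cnj x = 1"
  by (simp add: complex_norm_square[symmetric])

lemma neg_power_nonzero_iff: "neg_power d \<noteq> 0 \<longleftrightarrow> norm d \<noteq> 1"
proof -
  have "neg_power d = of_real (1 - (norm d)\<^sup>2)"
    by (simp add: neg_power_def complex_norm_square del: of_real_power)
  then show ?thesis by (simp add: power2_eq_1_iff del: of_real_diff) (smt (verit) norm_ge_zero)
qed

lemma tangent_chord_transitive:
  assumes "norm x = 1" "y \<noteq> x" "z \<noteq> x" "y \<noteq> z"
    and "neg_power d \<noteq> 0" "neg_power d' \<noteq> 0"
    and "tangent_chord d d' x y" "tangent_chord d d' x z"
  shows "tangent_chord d d' y z"
proof -
  let ?N = "blaschke_num d d'" and ?M = "blaschke_den d d'"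
  have "1 - cnj e * x \<noteq> 0" if "neg_power e \<noteq> 0" for e
  proof
    assume "1 - cnj e * x = 0"
    then have "norm e = 1" 
      by (metis assms(1) complex_mod_cnj eq_iff_diff_eq_0 mult.right_neutral norm_mult norm_one)
    then show False using that by (simp add: neg_power_nonzero_iff)
  qed
  then have "?M x \<noteq> 0" using assms(5,6) unfolding blaschke_den_def by auto
  moreover have "?N x * ?M y = ?N y * ?M x" "?N x * ?M z = ?N z * ?M x"
    using tangent_chord_iff_blaschke assms by metis+
  then have "?M x * (?N y * ?M z - ?N z * ?M y) = 0" by algebra
  ultimately show ?thesis using tangent_chord_iff_blaschke[OF assms(4)] by simp
qed

text \<open>The numbers \<open>p, q, s\<close> have to be the roots of \<open>blaschke_num = \<lambda> blaschke_den\<close>. Comparing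
  constant terms forces \<open>\<lambda> = p q s\<close>; the coefficient of \<open>z\<^sup>2\<close> is the real-linear equation \<open>e1\<close> for
  \<open>d'\<close> below, which is solvable as \<open>|d| \<noteq> 1\<close>; the coefficient of \<open>z\<close> gives its
  conjugate times \<open>p q s\<close>.
  The solution \<open>d'\<close> is the isogonal conjugate of \<open>d\<close>.\<close>

lemma exists_second_focus:
  assumes "norm p = 1" "norm q = 1" "norm s = 1" "p \<noteq> q" "q \<noteq> s" "s \<noteq> p"
    and "neg_power d \<noteq> 0" "chord d p q \<noteq> 0" "chord d q s \<noteq> 0" "chord d s p \<noteq> 0"
  obtains d' where "neg_power d' \<noteq> 0"
    "tangent_chord d d' p q" "tangent_chord d d' q s" "tangent_chord d d' s p"
proof -
  have u: "p * cnj p = 1" "q * cnj q = 1" "s * cnj s = 1"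
    using assms unit_mult_cnj by auto
  define d' where
    "d' = (p + q + s - d - (p * q + q * s + s * p) * cnj d + p * q * s * (cnj d)\<^sup>2) / neg_power d"
  have real: "cnj (neg_power d) = neg_power d" by (simp add: neg_power_def)
  have d': "neg_power d * d' = p + q + s - d - (p * q + q * s + s * p) * cnj d + p * q * s * (cnj d)\<^sup>2"
    using assms(7) by (simp add: d'_def)
  have cd': "neg_power d * cnj d' = cnj p + cnj q + cnj s - cnj d
      - (cnj p * cnj q + cnj q * cnj s + cnj s * cnj p) * d + cnj p * cnj q * cnj s * d\<^sup>2"
    using arg_cong[OF d', of cnj] real by simp
  have "neg_power d * (d' + p * q * s * cnj d * cnj d') = neg_power d * (p + q + s - d)"
    using d' cd' u unfolding neg_power_def by algebra
  then have e1: "d' + p * q * s * cnj d * cnj d' = p + q + s - d"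
    using assms(7) by simp
  have e1_cnj: "cnj d' + cnj p * cnj q * cnj s * d * d' = cnj p + cnj q + cnj s - cnj d"
    using arg_cong[OF e1, of cnj] by simp
  have e2: "d * d' + p * q * s * (cnj d + cnj d') = p * q + q * s + s * p"
    using e1_cnj u by algebra
  have split: "blaschke_num d d' t - p * q * s * blaschke_den d d' t = (t - p) * (t - q) * (t - s)" for t
    using e1 e2 unfolding blaschke_num_def blaschke_den_def by algebra
  have same_value: "blaschke_num d d' p = p * q * s * blaschke_den d d' p"
    "blaschke_num d d' q = p * q * s * blaschke_den d d' q"
    "blaschke_num d d' s = p * q * s * blaschke_den d d' s"
    using split[of p] split[of q] split[of s] by auto
  then have t: "tangent_chord d d' p q" "tangent_chord d d' q s" "tangent_chord d d' s p"
    using assms(4-6) by (simp_all add: tangent_chord_iff_blaschke)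
  \<comment> \<open>With \<open>d'\<close> on the unit circle the conic degenerates and all three sides would have to pass
    through \<open>d'\<close>.\<close>
  moreover have "neg_power d' \<noteq> 0"
  proof
    assume "neg_power d' = 0"
    then have "chord d' p q = 0" "chord d' q s = 0" "chord d' s p = 0"
      using t assms(8-10) by (auto simp: tangent_chord_def)
    then have "(p - s) * (1 - q * cnj d') = 0" "(q - p) * (1 - s * cnj d') = 0"
      unfolding chord_def by algebra+
    then have "q * cnj d' = 1" "s * cnj d' = 1" using assms(4,6) by auto
    then show False using assms(5) by (metis mult_cancel_right zero_neq_one mult_zero_right)
  qed
  ultimately show thesis using that by blast
qed

lemma tangent_chord_avoids_focus:
  assumes "tangent_chord d d' x y" "neg_power d \<noteq> 0" "neg_power d' \<noteq> 0" "norm x = 1" "norm y = 1"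
  shows "chord d x y \<noteq> 0"
  using assms by (auto simp: tangent_chord_def)

section \<open>The dual circle\<close>

text \<open>Here \<open>q\<close> is the pole of the chord \<open>xy\<close>, as a vector from \<open>d\<close>. The first equation says that it
  is perpendicular to the chord.\<close>

lemma pole_of_chord:
  assumes "norm x = 1" "norm y = 1" "x \<noteq> y"
    and "(x - d) * cnj q + cnj (x - d) * q = \<rho>"
    and "(y - d) * cnj q + cnj (y - d) * q = \<rho>"
  shows "q = x * y * cnj q" "cnj q * chord d x y = \<rho>"
proof -
  have x: "x * cnj x = 1" and y: "y * cnj y = 1"
    using assms unit_mult_cnj by auto
  have "(x - y) * (x * y * cnj q - q) = 0"
    using x y assms(4,5) unfolding complex_cnj_diff by algebra
  then show q: "q = x * y * cnj q" using assms(3) by simp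
  show "cnj q * chord d x y = \<rho>"
    using x y assms(4) q unfolding complex_cnj_diff chord_def by algebra
qed

text \<open>Put \<open>w = neg_power d * neg_power d'\<close>. As \<open>x y = q / cnj q\<close>, \<open>chord d x y = \<rho> / cnj q\<close> and
  \<open>chord d x y - chord d' x y = (d' - d) + x y cnj (d' - d)\<close>, multiplying the tangency relation
  \<open>chord d x y * chord d' x y = w x y\<close> by \<open>(cnj q)\<^sup>2\<close> eliminates \<open>x\<close> and \<open>y\<close>. What remains is
  the equation of a circle with centre \<open>m = \<rho> (d - d') / w\<close>.\<close>

lemma pole_on_dual_circle_iff:
  assumes "neg_power d \<noteq> 0" "neg_power d' \<noteq> 0"
    and m: "m = \<rho> * (d - d') / (neg_power d * neg_power d')" and "cnj \<rho> = \<rho>" "\<rho> \<noteq> 0"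
    and "norm x = 1" "norm y = 1" "x \<noteq> y"
    and "(x - d) * cnj q + cnj (x - d) * q = \<rho>"
    and "(y - d) * cnj q + cnj (y - d) * q = \<rho>"
  shows "(q - m) * cnj (q - m) = m * cnj m + \<rho>\<^sup>2 / (neg_power d * neg_power d') \<longleftrightarrow>
    tangent_chord d d' x y"
proof -
  define w where "w = neg_power d * neg_power d'"
  note q = pole_of_chord[OF assms(6-10)]
  have "w \<noteq> 0" using assms(1,2) by (simp add: w_def)
  have "cnj w = w" by (simp add: w_def neg_power_def mult.commute)
  then have wm: "w * m = \<rho> * (d - d')" "w * cnj m = \<rho> * (cnj d - cnj d')"
    using m assms(4) \<open>w \<noteq> 0\<close> by (auto simp: w_def[symmetric])
  have "cnj q \<noteq> 0" using q(2) assms(5) by auto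
  have "w * ((q - m) * cnj (q - m) - m * cnj m) - \<rho>\<^sup>2 =
      (cnj q)\<^sup>2 * (w * (x * y) - chord d x y * chord d' x y)"
    using q wm unfolding chord_def complex_cnj_diff by algebra
  moreover have "(q - m) * cnj (q - m) = m * cnj m + \<rho>\<^sup>2 / w \<longleftrightarrow> 
     w * ((q - m) * cnj (q - m) - m * cnj m) - \<rho>\<^sup>2 = 0"
    using \<open>w \<noteq> 0\<close> by (auto simp: field_simps)
  ultimately show ?thesis using \<open>cnj q \<noteq> 0\<close> by (auto simp: tangent_chord_def w_def)
qed

section \<open>Complex coordinates adapted to a circle\<close>

definition unit_coord :: "point \<Rightarrow> real \<Rightarrow> point \<Rightarrow> complex" where
  "unit_coord c r X = Complex ((X$1 - c$1) / r) ((X$2 - c$2) / r)"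

lemma inner_unit_coord:
  assumes "0 < r"
  shows "(X - Z) \<bullet> (Y - W) =
    r\<^sup>2 * Re ((unit_coord c r X - unit_coord c r Z) * cnj (unit_coord c r Y - unit_coord c r W))"
  using assms by (simp add: unit_coord_def inner_vec_def sum_2 field_simps power2_eq_square)

lemma dist_unit_coord:
  assumes "0 < r"
  shows "norm (unit_coord c r X - unit_coord c r Y) = dist X Y / r"
proof -
  let ?z = "unit_coord c r X - unit_coord c r Y"
  have "Re (?z * cnj ?z) = (norm ?z)\<^sup>2" by (metis Re_complex_of_real complex_norm_square)
  then have "(dist X Y)\<^sup>2 = (r * norm ?z)\<^sup>2"
    using inner_unit_coord[OF assms, of X Y X Y c]
    by (simp only: dist_norm power2_norm_eq_inner power_mult_distrib)
  then show ?thesis using assms by (simp add: power2_eq_iff_nonneg)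
qed

lemma unit_coord_eq_iff: "0 < r \<Longrightarrow> unit_coord c r X = unit_coord c r Y \<longleftrightarrow> X = Y"
  using dist_unit_coord[of r c X Y] by auto

lemma norm_unit_coord: "0 < r \<Longrightarrow> norm (unit_coord c r X) = 1 \<longleftrightarrow> X \<in> sphere c r"
  using dist_unit_coord[of r c X c]
  by (auto simp: unit_coord_def dist_commute zero_complex.code[symmetric])

lemma unit_coord_surj:
  assumes "0 < r"
  obtains X where "unit_coord c r X = z"
proof
  show "unit_coord c r (vector [c$1 + r * Re z, c$2 + r * Im z]) = z"
    using assms by (simp add: unit_coord_def)
qed

lemma polar_unit_coord:
  fixes c :: point and r R :: real
  assumes "0 < r" "Z \<noteq> D" "X \<in> polar D R Z"
  defines "\<psi> \<equiv> unit_coord c r"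
  shows "(\<psi> X - \<psi> D) * cnj (\<psi> Z - \<psi> D) + cnj (\<psi> X - \<psi> D) * (\<psi> Z - \<psi> D) =
    of_real (2 * R\<^sup>2 / r\<^sup>2)"
proof -
  let ?t = "(\<psi> X - \<psi> D) * cnj (\<psi> Z - \<psi> D)"
  have "r\<^sup>2 * Re ?t = R\<^sup>2"
    using assms mem_polar inner_unit_coord[OF assms(1), of X D Z D c] by simp
  then have "2 * Re ?t = 2 * R\<^sup>2 / r\<^sup>2" using assms(1) by (simp add: field_simps)
  moreover have "?t + cnj ?t = of_real (2 * Re ?t)" by (rule complex_add_cnj)
  ultimately show ?thesis by simp
qed

lemma chord_zero_if_on_line:
  assumes "0 < r" "A \<in> sphere c r" "B \<in> sphere c r" "X \<in> line A B"
  shows "chord (unit_coord c r X) (unit_coord c r A) (unit_coord c r B) = 0"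
proof -
  obtain u v where uv: "u + v = 1" "X = u *\<^sub>R A + v *\<^sub>R B"
    using assms(4) by (auto simp: affine_hull_2)
  have u: "u = 1 - v" using uv by simp
  have X: "unit_coord c r X = of_real u * unit_coord c r A + of_real v * unit_coord c r B"
    unfolding uv(2) u unit_coord_def using assms(1)
    by (simp add: complex_eq_iff field_simps)
  have "unit_coord c r A * cnj (unit_coord c r A) = 1" "unit_coord c r B * cnj (unit_coord c r B) = 1"
    using assms norm_unit_coord unit_mult_cnj by auto
  moreover have "of_real u + of_real v = (1::complex)" using uv(1) by (metis of_real_1 of_real_add)
  moreover have "cnj (unit_coord c r X) =
      of_real u * cnj (unit_coord c r A) + of_real v * cnj (unit_coord c r B)"
    by (simp add: X)
  ultimately show ?thesis unfolding chord_def using X by algebra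
qed

lemma triangle_on_circle:
  assumes "0 < r" "A \<in> sphere c r" "B \<in> sphere c r" "C \<in> sphere c r" "A \<noteq> B" "B \<noteq> C" "C \<noteq> A"
  shows "is_triangle A B C"
proof -
  define x y z where "x = unit_coord c r A" and "y = unit_coord c r B" and "z = unit_coord c r C"
  have "z * cnj z = 1" using assms norm_unit_coord unit_mult_cnj by (auto simp: z_def)
  then have "z * chord z x y = (x - z) * (z - y)" unfolding chord_def by algebra
  moreover have "x \<noteq> z" "y \<noteq> z" using assms unit_coord_eq_iff by (auto simp: x_def y_def z_def)
  ultimately have "chord z x y \<noteq> 0" by auto
  then show ?thesis
    using assms chord_zero_if_on_line[of r A c B C] by (auto simp: is_triangle_iff x_def y_def z_def)
qed

section \<open>The porism\<close>

theorem proposition5: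
  fixes P Q S D :: point and R :: real and K :: "point set"
  assumes "is_triangle P Q S"
    and "is_circumcircle K P Q S"
    and "0 < R"
    and "D \<notin> line Q S" and "D \<notin> line S P" and "D \<notin> line P Q"
    and "D \<notin> K"
  shows "\<exists>Pp Qp Sp Kp.
           polar D R Q \<inter> polar D R S = {Pp} \<and>
           polar D R S \<inter> polar D R P = {Qp} \<and>
           polar D R P \<inter> polar D R Q = {Sp} \<and>
           is_triangle Pp Qp Sp \<and>
           is_circumcircle Kp Pp Qp Sp \<and>
           polar_poristic_pair D R Kp K"
proof -
  obtain c r where r: "0 < r" and K: "K = sphere c r"
    using assms(2) by (auto simp: is_circumcircle_def is_circle_def)
  have inK: "P \<in> K" "Q \<in> K" "S \<in> K" using assms(2) by (auto simp: is_circumcircle_def)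
  have distinct: "P \<noteq> Q" "Q \<noteq> S" "S \<noteq> P" using assms(1) by (auto simp: is_triangle_def insert_commute)
  obtain Pp Qp Sp where poles: "is_pole D R Pp (line Q S)" "is_pole D R Qp (line S P)"
      "is_pole D R Sp (line P Q)"
    using pole_exists assms(3-6) distinct by metis
  have dual: "polar_triangles D R P Q S Pp Qp Sp"
    using polar_trianglesI assms poles by blast
  then have t: "is_triangle Pp Qp Sp" by (simp add: polar_triangles_def)
  have meets: "polar D R Q \<inter> polar D R S = {Pp}" "polar D R S \<inter> polar D R P = {Qp}"
      "polar D R P \<inter> polar D R Q = {Sp}"
    using dual triangle_sides_meet_at_vertex[of Pp Sp Qp] triangle_sides_meet_at_vertex[of Qp Pp Sp]
      triangle_sides_meet_at_vertex[of Sp Qp Pp]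
    by (simp_all add: polar_triangles_def is_pole_def is_triangle_def insert_commute)

  define \<psi> where "\<psi> = unit_coord c r"
  define d where "d = \<psi> D"
  define \<rho> :: complex where "\<rho> = of_real (2 * R\<^sup>2 / r\<^sup>2)"
  have \<rho>: "cnj \<rho> = \<rho>" "\<rho> \<noteq> 0" using r assms(3) by (simp_all add: \<rho>_def)
  have unit: "norm (\<psi> X) = 1" if "X \<in> K" for X using that norm_unit_coord r K by (simp add: \<psi>_def)
  have inj: "\<psi> X = \<psi> Y \<longleftrightarrow> X = Y" for X Y using unit_coord_eq_iff r by (simp add: \<psi>_def)
  have dK: "neg_power d \<noteq> 0"
    using norm_unit_coord[OF r, of c D] assms(7) K
    by (simp add: neg_power_nonzero_iff d_def \<psi>_def del: mem_sphere)
  have polar_eq: "(\<psi> X - d) * cnj (\<psi> Z - d) + cnj (\<psi> X - d) * (\<psi> Z - d) = \<rho>"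
    if "X \<in> polar D R Z" "Z \<noteq> D" for X Z
    using polar_unit_coord[OF r that(2,1)] by (simp add: d_def \<rho>_def \<psi>_def)
  have on_polar: "X \<in> polar D R Z" "Y \<in> polar D R Z" "Z \<noteq> D" if "is_pole D R Z (line X Y)" for X Y Z
    using that endpoints_in_line by (auto simp: is_pole_def)
  have chord_nz: "chord d (\<psi> X) (\<psi> Y) \<noteq> 0"
    if "is_pole D R Z (line X Y)" "X \<in> K" "Y \<in> K" "X \<noteq> Y" for X Y Z
  proof -
    note on = on_polar[OF that(1)]
    have "cnj (\<psi> Z - d) * chord d (\<psi> X) (\<psi> Y) = \<rho>"
      using pole_of_chord(2)[of "\<psi> X" "\<psi> Y" d "\<psi> Z - d" \<rho>] unit polar_eq on that inj by blast
    then show ?thesis using \<rho> by auto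
  qed
  obtain d' where d': "neg_power d' \<noteq> 0" and sides: "tangent_chord d d' (\<psi> P) (\<psi> Q)"
      "tangent_chord d d' (\<psi> Q) (\<psi> S)" "tangent_chord d d' (\<psi> S) (\<psi> P)"
    using exists_second_focus[of "\<psi> P" "\<psi> Q" "\<psi> S" d] unit inK inj distinct dK chord_nz poles by metis

  \<comment> \<open>The circle \<open>Kp\<close> is written down with the centre found by dualising the conic; that it passes
    through all three poles then follows from the tangency of the three sides.\<close>
  define m where "m = \<rho> * (d - d') / (neg_power d * neg_power d')"
  obtain M where M: "\<psi> M = d + m" using unit_coord_surj[OF r, of c] unfolding \<psi>_def by metis
  define Kp where "Kp = sphere M (dist M Pp)"
  have on_dual_circle: "complex_of_real ((dist M Z / r)\<^sup>2) = 
        m * cnj m + \<rho>\<^sup>2 / (neg_power d * neg_power d') \<longleftrightarrow> tangent_chord d d' (\<psi> X) (\<psi> Y)"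
    if "is_pole D R Z (line X Y)" "X \<in> K" "Y \<in> K" "X \<noteq> Y" for X Y Z
  proof -
    note on = on_polar[OF that(1)]
    have "norm (\<psi> Z - d - m) = dist M Z / r"
      using dist_unit_coord[OF r, of c Z M] M by (simp add: \<psi>_def dist_commute algebra_simps)
    then have "complex_of_real ((dist M Z / r)\<^sup>2) = (\<psi> Z - d - m) * cnj (\<psi> Z - d - m)"
      by (metis complex_norm_square)
    then show ?thesis
      using pole_on_dual_circle_iff[OF dK d' m_def \<rho>, of "\<psi> X" "\<psi> Y" "\<psi> Z - d"]
        unit polar_eq on that inj by auto
  qed
  have Kp_iff: "Z \<in> Kp \<longleftrightarrow> tangent_chord d d' (\<psi> X) (\<psi> Y)"
    if "is_pole D R Z (line X Y)" "X \<in> K" "Y \<in> K" "X \<noteq> Y" for X Y Z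
  proof -
    have "Z \<in> Kp \<longleftrightarrow> (dist M Z / r)\<^sup>2 = (dist M Pp / r)\<^sup>2"
      using r by (simp add: Kp_def power2_eq_iff_nonneg)
    also have "\<dots> \<longleftrightarrow> complex_of_real ((dist M Z / r)\<^sup>2) = complex_of_real ((dist M Pp / r)\<^sup>2)"
      by (simp only: of_real_eq_iff)
    also have "\<dots> \<longleftrightarrow> tangent_chord d d' (\<psi> X) (\<psi> Y)"
      using on_dual_circle[OF that] on_dual_circle[OF poles(1) inK(2,3) distinct(2)] sides(2) by simp
    finally show ?thesis .
  qed
  have in_Kp: "Pp \<in> Kp" "Qp \<in> Kp" "Sp \<in> Kp"
    using Kp_iff poles inK distinct sides by blast+
  have "dist M Pp \<noteq> 0" using in_Kp t by (auto simp: Kp_def is_triangle_def)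
  then have circ: "is_circumcircle Kp Pp Qp Sp"
    using in_Kp unfolding is_circumcircle_def is_circle_def Kp_def
    by (metis zero_le_dist less_eq_real_def)

  have "polar_poristic_pair D R Kp K"
    unfolding polar_poristic_pair_def
  proof (intro allI impI)
    fix A B C Bp Cp
    assume A: "A \<in> K" and pA: "polar D R A \<inter> Kp = {Bp, Cp}" and ne: "Bp \<noteq> Cp"
      and pB: "polar D R Bp \<inter> K = {A, C}" and "C \<noteq> A"
      and pC: "polar D R Cp \<inter> K = {A, B}" and "B \<noteq> A"
    have BC: "B \<in> K" "C \<in> K" and p: "Bp \<in> Kp" "Cp \<in> Kp" using pA pB pC by auto
    have "A \<noteq> D" using A assms(7) by auto
    then have D: "Bp \<noteq> D" "Cp \<noteq> D" using centre_notin_polar[of A D R] assms(3) pA by auto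
    have poleB: "is_pole D R Bp (line C A)" and poleC: "is_pole D R Cp (line A B)"
      using D polar_eq_line[of Bp D C A R] polar_eq_line[of Cp D A B R] pB pC \<open>C \<noteq> A\<close> \<open>B \<noteq> A\<close>
      by (auto simp: is_pole_def)
    \<comment> \<open>\<open>B = C\<close> would give \<open>Bp\<close> and \<open>Cp\<close> the same polar.\<close>
    have "B \<noteq> C" using pole_unique[of D R Bp _ Cp] poleB poleC assms(3) ne by (metis insert_commute)
    have tAC: "tangent_chord d d' (\<psi> A) (\<psi> C)" and tAB: "tangent_chord d d' (\<psi> A) (\<psi> B)"
      using Kp_iff[of Bp A C] Kp_iff[of Cp A B] poleB poleC A BC p \<open>C \<noteq> A\<close> \<open>B \<noteq> A\<close>
      by (simp_all add: insert_commute)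
    have tBC: "tangent_chord d d' (\<psi> B) (\<psi> C)"
      using tangent_chord_transitive[OF unit[OF A] _ _ _ dK d' tAB tAC] inj \<open>C \<noteq> A\<close> \<open>B \<noteq> A\<close> \<open>B \<noteq> C\<close>
      by simp
    then have "chord d (\<psi> B) (\<psi> C) \<noteq> 0"
      using tangent_chord_avoids_focus dK d' unit BC by blast
    then have "D \<notin> line B C"
      using chord_zero_if_on_line[OF r, of B c C D] BC K by (auto simp: d_def \<psi>_def)
    then obtain Ap where Ap: "is_pole D R Ap (line B C)"
      using pole_exists \<open>B \<noteq> C\<close> assms(3) by blast
    moreover have "Ap \<in> Kp" using Kp_iff Ap BC \<open>B \<noteq> C\<close> tBC by blast
    moreover have "is_triangle A B C"
      using triangle_on_circle[OF r, of A c B C] A BC K \<open>C \<noteq> A\<close> \<open>B \<noteq> A\<close> \<open>B \<noteq> C\<close> by auto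
    ultimately show "\<exists>Ap. is_pole D R Ap (line B C) \<and>
        polar_triangles D R A B C Ap Bp Cp \<and> Ap \<in> Kp"
      using polar_trianglesI assms(3) poleB poleC by blast
  qed
  then show ?thesis using meets t circ by blast
qed

end
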